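(* Let $a,\kappa,T_{\rm i}>0$. Let $(\alpha_-,u_-,T_-)$ with $\alpha_-\in(0,1)$, $T_->0$, $u_->0$ be the state ahead of (to the left of) the reflected shock wave, and let $(\alpha_\sharp,u_\sharp,T_\sharp)$ with $u_\sharp=0$ be the state behind (to the right of) the reflected shock wave, whose speed is denoted by $-U_R$. Set $D_-=\dfrac{u_-^2}{a^2\theta_-}$. If $D_-\ge\frac13$, then the Lax shock conditions for a backward shock wave hold for the reflected shock wave, i.e. $$u_\sharp-c_\sharp<-U_R<u_\sharp,\qquad -U_R<u_--c_- .$$
   Context: Model: one-dimensional ionized monatomic gas, with degree of ionization $\alpha\in(0,1)$, velocity $u$, temperature $T>0$, and constants $a>0$, $\kappa>0$ (Saha constant), $T_{\rm i}>0$ (ionization temperature). Put $\theta=(1+\alpha)T$. Saha's law gives the pressure $$p=p(\alpha,T)=\frac1\kappa\,\frac{1-\alpha^2}{\alpha^2}\,T^{5/2}e^{-T_{\rm i}/T}.$$ The density is $\rho=p/(a^2\theta)$, the specific volume is $v=1/\rho$, the specific internal energy is $e=\frac32a^2\theta+a^2T_{\rm i}\alpha$, and the specific total energy is $E=\frac{u^2}{2}+e$. The sound speed is $$c=a\sqrt{\frac{5\theta}{3}}\sqrt{\frac{1+\alpha(1-\alpha)\left(\frac54+\frac{T_{\rm i}}{T}+\frac{T_{\rm i}^2}{5T^2}\right)}{1+\alpha(1-\alpha)\left(\frac54+\frac{T_{\rm i}}{T}+\frac{T_{\rm i}^2}{3T^2}\right)}} .$$ The reflected shock wave is the discontinuity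 with left state $(\alpha_-,u_-,T_-)$, right state $(\alpha_\sharp,0,T_\sharp)$ and speed $U=-U_R$, where $(\alpha_\sharp,T_\sharp)$ is the unique pair with $\alpha_\sharp\in(\alpha_-,1)$ such that the Rankine-Hugoniot conditions $$U(\rho_\sharp-\rho_-)=\rho_\sharp u_\sharp-\rho_-u_-,$$ $$U(\rho_\sharp u_\sharp-\rho_-u_-)=\rho_\sharp u_\sharp^2+p_\sharp-\rho_-u_-^2-p_-,$$ $$U(\rho_\sharp E_\sharp-\rho_-E_-)=(\rho_\sharp u_\sharp E_\sharp+p_\sharp u_\sharp)-(\rho_-u_-E_-+p_-u_-)$$ hold for some $U$ (existence and uniqueness of this pair are known; $U$ is then determined by the first condition). Subscripts $-$ and $\sharp$ denote quantities of the corresponding state. *)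

theory Defs
  imports Complex_Main
begin

text \<open>
  One-dimensional flow of an ionized monatomic gas.  The parameters \<open>a\<close>, \<open>\<kappa>\<close> (Saha constant) and
  \<open>Ti\<close> (ionization temperature) are positive constants; a state consists of the degree of
  ionization \<open>\<alpha>\<close>, the velocity \<open>u\<close> and the temperature \<open>T\<close>.
\<close>

definition theta :: "real \<Rightarrow> real \<Rightarrow> real" where
  "theta \<alpha> T = (1 + \<alpha>) * T"

text \<open>Pressure, according to Saha's law.\<close>

definition pressure :: "real \<Rightarrow> real \<Rightarrow> real \<Rightarrow> real \<Rightarrow> real" where
  "pressure \<kappa> Ti \<alpha> T = 1 / \<kappa> * ((1 - \<alpha>\<^sup>2) / \<alpha>\<^sup>2) * T powr (5/2) * exp (- Ti / T)"

definition density :: "real \<Rightarrow> real \<Rightarrow> real \<Rightarrow> real \<Rightarrow> real \<Rightarrow> real" where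
  "density a \<kappa> Ti \<alpha> T = pressure \<kappa> Ti \<alpha> T / (a\<^sup>2 * theta \<alpha> T)"

definition internal_energy :: "real \<Rightarrow> real \<Rightarrow> real \<Rightarrow> real \<Rightarrow> real" where
  "internal_energy a Ti \<alpha> T = 3/2 * a\<^sup>2 * theta \<alpha> T + a\<^sup>2 * Ti * \<alpha>"

definition total_energy :: "real \<Rightarrow> real \<Rightarrow> real \<Rightarrow> real \<Rightarrow> real \<Rightarrow> real" where
  "total_energy a Ti \<alpha> u T = u\<^sup>2 / 2 + internal_energy a Ti \<alpha> T"

definition sound_speed :: "real \<Rightarrow> real \<Rightarrow> real \<Rightarrow> real \<Rightarrow> real" where
  "sound_speed a Ti \<alpha> T =
     a * sqrt (5 * theta \<alpha> T / 3) *
     sqrt ((1 + \<alpha> * (1 - \<alpha>) * (5/4 + Ti / T + Ti\<^sup>2 / (5 * T\<^sup>2))) /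
           (1 + \<alpha> * (1 - \<alpha>) * (5/4 + Ti / T + Ti\<^sup>2 / (3 * T\<^sup>2))))"

text \<open>
  Rankine-Hugoniot conditions for a discontinuity of speed \<open>U\<close> with left state \<open>(\<alpha>l, ul, Tl)\<close>
  and right state \<open>(\<alpha>r, ur, Tr)\<close>.
\<close>

definition rankine_hugoniot ::
  "real \<Rightarrow> real \<Rightarrow> real \<Rightarrow> real \<Rightarrow> real \<times> real \<times> real \<Rightarrow> real \<times> real \<times> real \<Rightarrow> bool" where
  "rankine_hugoniot a \<kappa> Ti U = (\<lambda>(\<alpha>l, ul, Tl) (\<alpha>r, ur, Tr).
     let \<rho>l = density a \<kappa> Ti \<alpha>l Tl; \<rho>r = density a \<kappa> Ti \<alpha>r Tr;
         pl = pressure \<kappa> Ti \<alpha>l Tl; pr = pressure \<kappa> Ti \<alpha>r Tr;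
         El = total_energy a Ti \<alpha>l ul Tl; Er = total_energy a Ti \<alpha>r ur Tr
     in U * (\<rho>r - \<rho>l) = \<rho>r * ur - \<rho>l * ul \<and>
        U * (\<rho>r * ur - \<rho>l * ul) = \<rho>r * ur\<^sup>2 + pr - \<rho>l * ul\<^sup>2 - pl \<and>
        U * (\<rho>r * Er - \<rho>l * El) = (\<rho>r * ur * Er + pr * ur) - (\<rho>l * ul * El + pl * ul))"

text \<open>
  The reflected shock wave: the right state is at rest and more strongly ionized than the left
  one.  \<open>U\<close> is the signed speed, so it is \<open>- U\<^sub>R\<close> for the shock reflected to the left.  The pair
  \<open>(\<alpha>r, Tr)\<close> and the speed are known to be uniquely determined by the left state when \<open>ul > 0\<close>,
  so a predicate is used in place of a description.
\<close>

definition reflected_shock ::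
  "real \<Rightarrow> real \<Rightarrow> real \<Rightarrow> real \<Rightarrow> real \<times> real \<times> real \<Rightarrow> real \<times> real \<times> real \<Rightarrow> bool" where
  "reflected_shock a \<kappa> Ti U = (\<lambda>(\<alpha>l, ul, Tl) (\<alpha>r, ur, Tr).
     \<alpha>l < \<alpha>r \<and> \<alpha>r < 1 \<and> Tr > 0 \<and> ur = 0 \<and>
     rankine_hugoniot a \<kappa> Ti U (\<alpha>l, ul, Tl) (\<alpha>r, ur, Tr))"

end

theory Submission
  imports Defs
begin

text \<open>
  Since \<open>a\<^sup>2 \<theta> < c\<^sup>2 < 5/3 a\<^sup>2 \<theta>\<close>, the shock conditions reduce to \<open>U\<^sub>R\<^sup>2 \<le> a\<^sup>2 \<theta>\<^sub>\<sharp>\<close> and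
  \<open>(u\<^sub>- + U\<^sub>R)\<^sup>2 \<ge> 5/3 a\<^sup>2 \<theta>\<^sub>-\<close>.  As \<open>\<alpha>\<close> increases, the Hugoniot relation bounds the specific volume
  from above by that of the unionized polytropic gas: \<open>v\<^sub>\<sharp> (4 p\<^sub>\<sharp> + p\<^sub>-) < v\<^sub>- (4 p\<^sub>- + p\<^sub>\<sharp>)\<close>.  Combined
  with Saha's law this forces \<open>p\<^sub>\<sharp> > p\<^sub>-\<close>, hence \<open>T\<^sub>\<sharp> > T\<^sub>-\<close>.  Both reduced inequalities are then
  algebraic consequences of these bounds and of
  \<open>D\<^sub>- = (p\<^sub>\<sharp> - p\<^sub>-) (v\<^sub>- - v\<^sub>\<sharp>) / (p\<^sub>- v\<^sub>-) \<ge> 1/3\<close>.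
\<close>

section \<open>Bounds on the sound speed\<close>

lemma sound_speed_bounds:
  assumes "a > 0" "Ti > 0" "0 < \<alpha>" "\<alpha> < 1" "T > 0"
  shows "0 \<le> sound_speed a Ti \<alpha> T"
    and "a\<^sup>2 * theta \<alpha> T < (sound_speed a Ti \<alpha> T)\<^sup>2"
    and "(sound_speed a Ti \<alpha> T)\<^sup>2 < 5/3 * (a\<^sup>2 * theta \<alpha> T)"
proof -
  define A where "A = 1 + \<alpha> * (1 - \<alpha>) * (5/4 + Ti / T + Ti\<^sup>2 / (5 * T\<^sup>2))"
  define B where "B = 1 + \<alpha> * (1 - \<alpha>) * (5/4 + Ti / T + Ti\<^sup>2 / (3 * T\<^sup>2))"
  define w where "w = \<alpha> * (1 - \<alpha>)"
  define x where "x = Ti / T"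
  have wx: "w > 0" "x > 0" using assms by (auto simp: w_def x_def)
  have A: "A = 1 + w * (5/4 + x + x\<^sup>2 / 5)" and B: "B = 1 + w * (5/4 + x + x\<^sup>2 / 3)"
    unfolding A_def B_def w_def x_def by (simp_all add: power_divide)
  have pos: "w * x > 0" "w * x\<^sup>2 > 0" using wx by simp_all
  \<comment> \<open>In \<open>5 * A - 3 * B\<close> the terms in \<open>x\<^sup>2\<close> cancel and
    only positive ones remain. This places \<open>A / B\<close> strictly between 3/5 and 1, the
    values that would give the isothermal and the polytropic sound speed.\<close>
  have AB: "A > 0" "B > 0" "A < B" "3 * B < 5 * A"
    using wx pos unfolding A B by (simp_all add: algebra_simps add_pos_pos)
  have th: "theta \<alpha> T > 0" using assms by (simp add: theta_def)
  have c: "sound_speed a Ti \<alpha> T = a * sqrt (5 * theta \<alpha> T / 3) * sqrt (A / B)"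
    unfolding sound_speed_def A_def B_def ..
  show "0 \<le> sound_speed a Ti \<alpha> T" unfolding c using assms AB th by simp
  have c2: "(sound_speed a Ti \<alpha> T)\<^sup>2 = 5/3 * (a\<^sup>2 * theta \<alpha> T) * (A / B)"
    unfolding c power_mult_distrib using AB th by simp
  have ath: "a\<^sup>2 * theta \<alpha> T > 0" using assms th by simp
  have ab: "A / B < 1" "3/5 < A / B" using AB by (simp_all add: field_simps)
  show "a\<^sup>2 * theta \<alpha> T < (sound_speed a Ti \<alpha> T)\<^sup>2"
    using mult_strict_left_mono[OF ab(2), of "5/3 * (a\<^sup>2 * theta \<alpha> T)"] ath unfolding c2
    by (simp add: mult_ac)
  show "(sound_speed a Ti \<alpha> T)\<^sup>2 < 5/3 * (a\<^sup>2 * theta \<alpha> T)"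
    using mult_strict_left_mono[OF ab(1), of "5/3 * (a\<^sup>2 * theta \<alpha> T)"] ath unfolding c2 by simp
qed

section \<open>Saha's law in logarithmic form and the polytropic comparison\<close>

lemma pressure_pos:
  assumes "\<kappa> > 0" "0 < \<alpha>" "\<alpha> < 1" "T > 0"
  shows "pressure \<kappa> Ti \<alpha> T > 0"
proof -
  have "\<alpha>\<^sup>2 < 1" using assms by (simp add: power_less_one_iff)
  then show ?thesis using assms by (simp add: pressure_def)
qed

text \<open>Taking logarithms separates the dependence on \<alpha> from that on \<open>T\<close>,
  each part being monotone, so that pressures can be compared by linear arithmetic.\<close>

lemma ln_pressure:
  assumes "\<kappa> > 0" "0 < \<alpha>" "\<alpha> < 1" "T > 0"
  shows "ln (pressure \<kappa> Ti \<alpha> T) = - ln \<kappa> + ln ((1 - \<alpha>\<^sup>2) / \<alpha>\<^sup>2) + 5/2 * ln T - Ti / T"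
proof -
  have "\<alpha>\<^sup>2 < 1" using assms by (simp add: power_less_one_iff)
  then show ?thesis using assms by (simp add: pressure_def ln_mult ln_powr ln_div)
qed

lemma ln_saha_fraction_less:
  fixes \<alpha> \<beta> :: real
  assumes "0 < \<alpha>" "\<alpha> < \<beta>" "\<beta> < 1"
  shows "ln ((1 - \<beta>\<^sup>2) / \<beta>\<^sup>2) < ln ((1 - \<alpha>\<^sup>2) / \<alpha>\<^sup>2)"
proof -
  have "\<beta>\<^sup>2 < 1" "\<alpha>\<^sup>2 < \<beta>\<^sup>2" using assms by (simp_all add: power_less_one_iff power_strict_mono)
  then show ?thesis using assms
    by (subst ln_less_cancel_iff) (auto intro!: frac_less2)
qed

text \<open>
  The entropy inequality for the Hugoniot curve of a polytropic gas with adiabatic exponent 5/3,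
  \<open>r\<close> being a pressure ratio.
\<close>
lemma polytropic_hugoniot_ln_le:
  fixes r :: real
  assumes "r \<ge> 1"
  shows "ln r \<le> 5/2 * (ln (4 + r) - ln (4 * r + 1) + ln r)"
proof -
  define g where "g = (\<lambda>x::real. 5/2 * (ln (4 + x) - ln (4 * x + 1) + ln x) - ln x)"
  have "g 1 \<le> g r"
  proof (rule DERIV_nonneg_imp_nondecreasing[OF assms])
    fix x :: real
    assume x: "1 \<le> x" "x \<le> r"
    have "(g has_real_derivative 5/2 * (1 / (4 + x) - 4 / (4 * x + 1) + 1 / x) - 1 / x) (at x)"
      unfolding g_def using x by (auto intro!: derivative_eq_intros)
    \<comment> \<open>Since \<open>g 1 = 0\<close>, it suffices that the derivative is a square over
      positive factors. Its double zero at \<open>x = 1\<close> reflects that entropy changes only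
      to third order across weak shocks.\<close>
    moreover have "5/2 * (1 / (4 + x) - 4 / (4 * x + 1) + 1 / x) - 1 / x
        = 6 * (x - 1)\<^sup>2 / ((4 + x) * (4 * x + 1) * x)"
      using x by (simp add: divide_simps power2_eq_square) (simp add: algebra_simps)
    moreover have "6 * (x - 1)\<^sup>2 / ((4 + x) * (4 * x + 1) * x) \<ge> 0" using x by simp
    ultimately show "\<exists>y. (g has_real_derivative y) (at x) \<and> 0 \<le> y" by metis
  qed
  then show ?thesis by (simp add: g_def)
qed

section \<open>Jump conditions and the direction of the jump\<close>

text \<open>\<open>m\<close> is the mass flux through the front: in the frame of the front, the gas
  moves at \<open>m\<close> times its specific volume on either side. As \<open>u > 0\<close> forces
  \<open>m \<noteq> 0\<close>, the energy balance can be divided by \<open>m\<close>; eliminating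
  \<open>u\<close> then leaves the Hugoniot relation, which is free of velocities.\<close>

lemma rankine_hugoniot_flux:
  fixes p\<^sub>0 p\<^sub>1 v\<^sub>0 v\<^sub>1 e\<^sub>0 e\<^sub>1 u R :: real
  assumes pos: "p\<^sub>0 > 0" "v\<^sub>0 > 0" "v\<^sub>1 > 0" "u > 0"
    and mass: "- R * (1 / v\<^sub>1 - 1 / v\<^sub>0) = - (1 / v\<^sub>0 * u)"
    and momentum: "- R * - (1 / v\<^sub>0 * u) = p\<^sub>1 - 1 / v\<^sub>0 * u\<^sup>2 - p\<^sub>0"
    and energy: "- R * (1 / v\<^sub>1 * e\<^sub>1 - 1 / v\<^sub>0 * (u\<^sup>2 / 2 + e\<^sub>0))
      = - (1 / v\<^sub>0 * u * (u\<^sup>2 / 2 + e\<^sub>0) + p\<^sub>0 * u)"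
  obtains m where "R = m * v\<^sub>1" "R + u = m * v\<^sub>0" "p\<^sub>1 - p\<^sub>0 = m * u"
    and "2 * (e\<^sub>1 - e\<^sub>0) = (p\<^sub>1 + p\<^sub>0) * (v\<^sub>0 - v\<^sub>1)"
proof
  define m where "m = R / v\<^sub>1"
  show R: "R = m * v\<^sub>1" using pos by (simp add: m_def)
  have "m = (R + u) / v\<^sub>0" using mass by (simp add: m_def field_simps add_divide_distrib)
  then show Ru: "R + u = m * v\<^sub>0" using pos by simp
  have u: "u = m * (v\<^sub>0 - v\<^sub>1)" using R Ru by (simp add: algebra_simps)
  have "u * ((R + u) / v\<^sub>0) = p\<^sub>1 - p\<^sub>0"
    using momentum by (simp add: field_simps power2_eq_square add_divide_distrib)
  then show pm: "p\<^sub>1 - p\<^sub>0 = m * u" using Ru pos by (simp add: field_simps)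
  have "(R / v\<^sub>1) * e\<^sub>1 = ((R + u) / v\<^sub>0) * (u\<^sup>2 / 2 + e\<^sub>0) + p\<^sub>0 * u"
    using energy by (simp add: algebra_simps add_divide_distrib)
  then have "m * e\<^sub>1 = m * (u\<^sup>2 / 2 + e\<^sub>0) + p\<^sub>0 * (m * (v\<^sub>0 - v\<^sub>1))"
    using Ru pos u by (simp add: m_def)
  then have "m * (e\<^sub>1 - (u\<^sup>2 / 2 + e\<^sub>0) - p\<^sub>0 * (v\<^sub>0 - v\<^sub>1)) = 0"
    by (simp add: algebra_simps)
  moreover have "m \<noteq> 0" using u pos by auto
  ultimately have "2 * (e\<^sub>1 - e\<^sub>0) = u\<^sup>2 + 2 * p\<^sub>0 * (v\<^sub>0 - v\<^sub>1)" by simp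
  moreover have "u\<^sup>2 = (p\<^sub>1 - p\<^sub>0) * (v\<^sub>0 - v\<^sub>1)"
    using u pm by (metis mult.assoc mult.commute power2_eq_square)
  ultimately show "2 * (e\<^sub>1 - e\<^sub>0) = (p\<^sub>1 + p\<^sub>0) * (v\<^sub>0 - v\<^sub>1)" by (simp add: algebra_simps)
qed

text \<open>An expansion would be too cold for Saha's law: if the pressure did not rise,
  \<open>hug\<close> would make the temperature drop so far that, with the higher ionization, the
  pressure ratio would exceed \<open>r\<close>. The entropy inequality
  \<open>polytropic_hugoniot_ln_le\<close> turns this into a contradiction.\<close>

lemma saha_hugoniot_compressive:
  fixes p\<^sub>0 p\<^sub>1 v\<^sub>0 v\<^sub>1 :: real
  assumes "a > 0" "\<kappa> > 0" "Ti > 0" "0 < \<alpha>\<^sub>0" "\<alpha>\<^sub>0 < \<alpha>\<^sub>1" "\<alpha>\<^sub>1 < 1" "T\<^sub>0 > 0" "T\<^sub>1 > 0"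
    and p: "p\<^sub>0 = pressure \<kappa> Ti \<alpha>\<^sub>0 T\<^sub>0" "p\<^sub>1 = pressure \<kappa> Ti \<alpha>\<^sub>1 T\<^sub>1"
    and v: "p\<^sub>0 * v\<^sub>0 = a\<^sup>2 * theta \<alpha>\<^sub>0 T\<^sub>0" "p\<^sub>1 * v\<^sub>1 = a\<^sup>2 * theta \<alpha>\<^sub>1 T\<^sub>1"
    and hug: "v\<^sub>1 * (4 * p\<^sub>1 + p\<^sub>0) < v\<^sub>0 * (4 * p\<^sub>0 + p\<^sub>1)"
  shows "p\<^sub>0 < p\<^sub>1"
proof (rule ccontr)
  assume "\<not> p\<^sub>0 < p\<^sub>1"
  define r where "r = p\<^sub>0 / p\<^sub>1"
  have pp: "p\<^sub>0 > 0" "p\<^sub>1 > 0" using assms by (auto intro!: pressure_pos)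
  have r: "r \<ge> 1" "p\<^sub>0 = r * p\<^sub>1" using pp \<open>\<not> p\<^sub>0 < p\<^sub>1\<close> by (simp_all add: r_def)
  have th: "theta \<alpha>\<^sub>0 T\<^sub>0 = (1 + \<alpha>\<^sub>0) * T\<^sub>0" "theta \<alpha>\<^sub>1 T\<^sub>1 = (1 + \<alpha>\<^sub>1) * T\<^sub>1"
    by (simp_all add: theta_def)
  have "p\<^sub>1 * (v\<^sub>1 * (4 + r)) < p\<^sub>1 * (v\<^sub>0 * (4 * r + 1))"
    using hug by (simp add: r(2) algebra_simps)
  \<comment> \<open>The factor \<open>r\<close> turns \<open>p\<^sub>1 * v\<^sub>0\<close> into
    \<open>p\<^sub>0 * v\<^sub>0\<close>, so that both sides can be expressed by
    \<open>theta\<close>.\<close>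
  then have "p\<^sub>1 * (v\<^sub>1 * (4 + r)) * r < p\<^sub>1 * (v\<^sub>0 * (4 * r + 1)) * r"
    using r by (intro mult_strict_right_mono) auto
  then have "(p\<^sub>1 * v\<^sub>1) * ((4 + r) * r) < (p\<^sub>0 * v\<^sub>0) * (4 * r + 1)"
    by (simp add: r(2) algebra_simps)
  then have "a\<^sup>2 * (theta \<alpha>\<^sub>1 T\<^sub>1 * ((4 + r) * r)) < a\<^sup>2 * (theta \<alpha>\<^sub>0 T\<^sub>0 * (4 * r + 1))"
    unfolding v by (simp add: algebra_simps)
  then have "theta \<alpha>\<^sub>1 T\<^sub>1 * ((4 + r) * r) < theta \<alpha>\<^sub>0 T\<^sub>0 * (4 * r + 1)"
    using assms(1) by simp
  moreover have "(1 + \<alpha>\<^sub>0) * T\<^sub>1 * ((4 + r) * r) \<le> theta \<alpha>\<^sub>1 T\<^sub>1 * ((4 + r) * r)"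
    unfolding th using assms r by (intro mult_right_mono) auto
  ultimately have "(1 + \<alpha>\<^sub>0) * (T\<^sub>1 * ((4 + r) * r)) < (1 + \<alpha>\<^sub>0) * (T\<^sub>0 * (4 * r + 1))"
    unfolding th by (simp add: algebra_simps)
  then have T: "T\<^sub>1 * ((4 + r) * r) < T\<^sub>0 * (4 * r + 1)" using assms by simp
  \<comment> \<open>This weakens \<open>T\<close> to a plain comparison of temperatures, needed for
    the exponential factor; the sharp form is kept for the power 5/2.\<close>
  have "r * r \<ge> 1 * 1" using r by (intro mult_mono) auto
  then have "T\<^sub>1 * (4 * r + 1) \<le> T\<^sub>1 * ((4 + r) * r)"
    using assms by (intro mult_left_mono) (auto simp: algebra_simps)
  with T have "T\<^sub>1 * (4 * r + 1) < T\<^sub>0 * (4 * r + 1)" by linarith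
  then have "T\<^sub>1 < T\<^sub>0" using r by simp
  then have exp_le: "Ti / T\<^sub>0 < Ti / T\<^sub>1" using assms by (simp add: frac_less2)
  have "ln (T\<^sub>1 * ((4 + r) * r)) < ln (T\<^sub>0 * (4 * r + 1))"
    using T assms r by (subst ln_less_cancel_iff) auto
  then have lnT: "ln T\<^sub>1 + ln (4 + r) + ln r < ln T\<^sub>0 + ln (4 * r + 1)"
    using assms r by (simp add: ln_mult)
  \<comment> \<open>By Saha's law \<open>ln r\<close> exceeds
    \<open>5/2 * (ln T\<^sub>0 - ln T\<^sub>1)\<close>, as the ionization and exponential terms add
    to it; by \<open>lnT\<close> this exceeds the right-hand side of the entropy inequality.\<close>
  have "ln r = ln p\<^sub>0 - ln p\<^sub>1" using pp by (simp add: r_def ln_div)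
  moreover have "ln p\<^sub>0 = - ln \<kappa> + ln ((1 - \<alpha>\<^sub>0\<^sup>2) / \<alpha>\<^sub>0\<^sup>2) + 5/2 * ln T\<^sub>0 - Ti / T\<^sub>0"
    unfolding p using assms by (intro ln_pressure) auto
  moreover have "ln p\<^sub>1 = - ln \<kappa> + ln ((1 - \<alpha>\<^sub>1\<^sup>2) / \<alpha>\<^sub>1\<^sup>2) + 5/2 * ln T\<^sub>1 - Ti / T\<^sub>1"
    unfolding p using assms by (intro ln_pressure) auto
  moreover have "ln ((1 - \<alpha>\<^sub>1\<^sup>2) / \<alpha>\<^sub>1\<^sup>2) < ln ((1 - \<alpha>\<^sub>0\<^sup>2) / \<alpha>\<^sub>0\<^sup>2)"
    using assms by (intro ln_saha_fraction_less) auto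
  ultimately show False
    using polytropic_hugoniot_ln_le[OF r(1)] lnT exp_le by (simp add: algebra_simps)
qed

text \<open>The Saha pressure decreases in \<alpha> and increases in \<open>T\<close>, so a rise of
  both pressure and ionization has to come from heating.\<close>

lemma temperature_less:
  assumes "\<kappa> > 0" "Ti > 0" "0 < \<alpha>\<^sub>0" "\<alpha>\<^sub>0 < \<alpha>\<^sub>1" "\<alpha>\<^sub>1 < 1" "T\<^sub>0 > 0" "T\<^sub>1 > 0"
    and "pressure \<kappa> Ti \<alpha>\<^sub>0 T\<^sub>0 < pressure \<kappa> Ti \<alpha>\<^sub>1 T\<^sub>1"
  shows "T\<^sub>0 < T\<^sub>1"
proof (rule ccontr)
  assume "\<not> T\<^sub>0 < T\<^sub>1"
  then have le: "ln T\<^sub>1 \<le> ln T\<^sub>0" "Ti / T\<^sub>0 \<le> Ti / T\<^sub>1" using assms by (simp_all add: frac_le)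
  have "ln (pressure \<kappa> Ti \<alpha>\<^sub>0 T\<^sub>0) < ln (pressure \<kappa> Ti \<alpha>\<^sub>1 T\<^sub>1)"
    using assms by (subst ln_less_cancel_iff) (auto intro!: pressure_pos)
  moreover have "ln ((1 - \<alpha>\<^sub>1\<^sup>2) / \<alpha>\<^sub>1\<^sup>2) < ln ((1 - \<alpha>\<^sub>0\<^sup>2) / \<alpha>\<^sub>0\<^sup>2)"
    using assms by (intro ln_saha_fraction_less) auto
  ultimately show False using le assms by (simp add: ln_pressure)
qed

section \<open>Algebraic bounds on the mass flux\<close>

text \<open>With \<open>m\<^sup>2 = (p\<^sub>1 - p\<^sub>0) / (v\<^sub>0 - v\<^sub>1)\<close> the
  conclusion says \<open>(m * v\<^sub>1)\<^sup>2 \<le> p\<^sub>1 * v\<^sub>1\<close>: the flow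
  behind is at most isothermally sonic relative to the front.\<close>

lemma flux_bound_behind:
  fixes p\<^sub>0 p\<^sub>1 v\<^sub>0 v\<^sub>1 :: real
  assumes pos: "p\<^sub>0 > 0" "p\<^sub>0 < p\<^sub>1" "v\<^sub>0 > 0" "v\<^sub>1 > 0"
    and hug: "v\<^sub>1 * (4 * p\<^sub>1 + p\<^sub>0) < v\<^sub>0 * (4 * p\<^sub>0 + p\<^sub>1)"
    and D: "p\<^sub>0 * v\<^sub>0 \<le> 3 * ((p\<^sub>1 - p\<^sub>0) * (v\<^sub>0 - v\<^sub>1))"
  shows "v\<^sub>1 * (p\<^sub>1 - p\<^sub>0) \<le> p\<^sub>1 * (v\<^sub>0 - v\<^sub>1)"
proof -
  have "v\<^sub>1 * (2 * p\<^sub>1 - p\<^sub>0) \<le> v\<^sub>0 * p\<^sub>1"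
  \<comment> \<open>For strong shocks \<open>hug\<close> suffices, for weak ones \<open>D\<close>
    does. The two upper bounds on \<open>v\<^sub>1\<close> agree at
    \<open>p\<^sub>1 = 2 * p\<^sub>0\<close>, both giving \<open>2/3 * v\<^sub>0\<close>; the
    constant 1/3 in the bound on \<open>D_minus\<close> is what makes the two ranges meet
    there.\<close>
  proof (cases "2 * p\<^sub>0 \<le> p\<^sub>1")
    case True
    have "(v\<^sub>1 * (2 * p\<^sub>1 - p\<^sub>0)) * (4 * p\<^sub>1 + p\<^sub>0) \<le> (v\<^sub>0 * (4 * p\<^sub>0 + p\<^sub>1)) * (2 * p\<^sub>1 - p\<^sub>0)"
      using mult_right_mono[of _ _ "2 * p\<^sub>1 - p\<^sub>0", OF less_imp_le[OF hug]] pos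
      by (simp add: mult_ac)
    also have "\<dots> = (v\<^sub>0 * p\<^sub>1) * (4 * p\<^sub>1 + p\<^sub>0) - 2 * v\<^sub>0 * ((p\<^sub>1 - p\<^sub>0) * (p\<^sub>1 - 2 * p\<^sub>0))"
      by (simp add: algebra_simps)
    also have "\<dots> \<le> (v\<^sub>0 * p\<^sub>1) * (4 * p\<^sub>1 + p\<^sub>0)" using True pos by simp
    finally show ?thesis using pos by simp
  next
    case False
    have "v\<^sub>1 * (3 * (p\<^sub>1 - p\<^sub>0)) \<le> v\<^sub>0 * (3 * p\<^sub>1 - 4 * p\<^sub>0)" using D by (simp add: algebra_simps)
    then have "(v\<^sub>1 * (2 * p\<^sub>1 - p\<^sub>0)) * (3 * (p\<^sub>1 - p\<^sub>0)) \<le> (v\<^sub>0 * (3 * p\<^sub>1 - 4 * p\<^sub>0)) * (2 * p\<^sub>1 - p\<^sub>0)"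
      using mult_right_mono[of _ _ "2 * p\<^sub>1 - p\<^sub>0"] pos by (simp add: mult_ac)
    also have "\<dots> = (v\<^sub>0 * p\<^sub>1) * (3 * (p\<^sub>1 - p\<^sub>0)) - v\<^sub>0 * ((3 * p\<^sub>1 - 2 * p\<^sub>0) * (2 * p\<^sub>0 - p\<^sub>1))"
      by (simp add: algebra_simps)
    also have "\<dots> \<le> (v\<^sub>0 * p\<^sub>1) * (3 * (p\<^sub>1 - p\<^sub>0))" using False pos by simp
    finally show ?thesis using pos by simp
  qed
  then show ?thesis by (simp add: algebra_simps)
qed

text \<open>In terms of the mass flux this is
  \<open>(m * v\<^sub>0)\<^sup>2 \<ge> 5/3 * (p\<^sub>0 * v\<^sub>0)\<close>. The assumption
  \<open>heat\<close> reduces it to a pressure ratio of at least 5/3.\<close>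

lemma flux_bound_ahead:
  fixes p\<^sub>0 p\<^sub>1 v\<^sub>0 v\<^sub>1 :: real
  assumes pos: "p\<^sub>0 > 0" "p\<^sub>0 < p\<^sub>1" "v\<^sub>0 > 0" "v\<^sub>1 < v\<^sub>0"
    and heat: "p\<^sub>0 * v\<^sub>0 \<le> p\<^sub>1 * v\<^sub>1"
    and D: "p\<^sub>0 * v\<^sub>0 \<le> 3 * ((p\<^sub>1 - p\<^sub>0) * (v\<^sub>0 - v\<^sub>1))"
  shows "5 * p\<^sub>0 * (v\<^sub>0 - v\<^sub>1) \<le> 3 * v\<^sub>0 * (p\<^sub>1 - p\<^sub>0)"
proof -
  have h: "p\<^sub>1 * (v\<^sub>0 - v\<^sub>1) \<le> v\<^sub>0 * (p\<^sub>1 - p\<^sub>0)" using heat by (simp add: algebra_simps)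
  \<comment> \<open>\<open>D\<close> and \<open>h\<close> give \<open>p\<^sub>0 * p\<^sub>1 \<le> 3
    * (p\<^sub>1 - p\<^sub>0)\<^sup>2\<close>. A ratio below 5/3 bounds
    \<open>3 * (p\<^sub>1 - p\<^sub>0)\<close> by \<open>2 * p\<^sub>0\<close>, whence
    \<open>p\<^sub>1 \<ge> 2 * p\<^sub>0\<close>, which is absurd.\<close>
  have "5 * p\<^sub>0 \<le> 3 * p\<^sub>1"
  proof (rule ccontr)
    assume neg: "\<not> 5 * p\<^sub>0 \<le> 3 * p\<^sub>1"
    have "v\<^sub>0 * (p\<^sub>0 * p\<^sub>1) = p\<^sub>1 * (p\<^sub>0 * v\<^sub>0)" by simp
    also have "\<dots> \<le> p\<^sub>1 * (3 * ((p\<^sub>1 - p\<^sub>0) * (v\<^sub>0 - v\<^sub>1)))" using D pos by (intro mult_left_mono) auto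
    also have "\<dots> = 3 * (p\<^sub>1 - p\<^sub>0) * (p\<^sub>1 * (v\<^sub>0 - v\<^sub>1))" by simp
    also have "\<dots> \<le> 3 * (p\<^sub>1 - p\<^sub>0) * (v\<^sub>0 * (p\<^sub>1 - p\<^sub>0))" using h pos by (intro mult_left_mono) auto
    also have "\<dots> = v\<^sub>0 * ((3 * (p\<^sub>1 - p\<^sub>0)) * (p\<^sub>1 - p\<^sub>0))" by simp
    finally have "p\<^sub>0 * p\<^sub>1 \<le> (3 * (p\<^sub>1 - p\<^sub>0)) * (p\<^sub>1 - p\<^sub>0)" using pos by simp
    also have "\<dots> \<le> (2 * p\<^sub>0) * (p\<^sub>1 - p\<^sub>0)" using neg pos by (intro mult_right_mono) auto
    also have "\<dots> = p\<^sub>0 * (2 * (p\<^sub>1 - p\<^sub>0))" by simp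
    finally show False using neg pos by simp
  qed
  then have "5 * p\<^sub>0 * (v\<^sub>0 - v\<^sub>1) \<le> 3 * p\<^sub>1 * (v\<^sub>0 - v\<^sub>1)" using pos by (intro mult_right_mono) auto
  with h show ?thesis by simp
qed

section \<open>Shock conditions from the flux bounds\<close>

theorem theorem5p2:
  fixes a \<kappa> Ti \<alpha>_minus u_minus T_minus \<alpha>_sharp u_sharp T_sharp U\<^sub>R D_minus :: real
  assumes "a > 0" and "\<kappa> > 0" and "Ti > 0"
    and "0 < \<alpha>_minus" and "\<alpha>_minus < 1" and "T_minus > 0" and "u_minus > 0"
    and "reflected_shock a \<kappa> Ti (- U\<^sub>R)
           (\<alpha>_minus, u_minus, T_minus) (\<alpha>_sharp, u_sharp, T_sharp)"
    and "D_minus = u_minus\<^sup>2 / (a\<^sup>2 * theta \<alpha>_minus T_minus)"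
    and "D_minus \<ge> 1/3"
  shows "u_sharp - sound_speed a Ti \<alpha>_sharp T_sharp < - U\<^sub>R \<and> - U\<^sub>R < u_sharp \<and>
         - U\<^sub>R < u_minus - sound_speed a Ti \<alpha>_minus T_minus"
proof -
  define p\<^sub>0 where "p\<^sub>0 = pressure \<kappa> Ti \<alpha>_minus T_minus"
  define p\<^sub>1 where "p\<^sub>1 = pressure \<kappa> Ti \<alpha>_sharp T_sharp"
  define v\<^sub>0 where "v\<^sub>0 = 1 / density a \<kappa> Ti \<alpha>_minus T_minus"
  define v\<^sub>1 where "v\<^sub>1 = 1 / density a \<kappa> Ti \<alpha>_sharp T_sharp"
  define e\<^sub>0 where "e\<^sub>0 = internal_energy a Ti \<alpha>_minus T_minus"
  define e\<^sub>1 where "e\<^sub>1 = internal_energy a Ti \<alpha>_sharp T_sharp"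
  define c\<^sub>0 where "c\<^sub>0 = sound_speed a Ti \<alpha>_minus T_minus"
  define c\<^sub>1 where "c\<^sub>1 = sound_speed a Ti \<alpha>_sharp T_sharp"
  have \<alpha>: "\<alpha>_minus < \<alpha>_sharp" "\<alpha>_sharp < 1" and T1: "T_sharp > 0" and u1: "u_sharp = 0"
    and rh: "rankine_hugoniot a \<kappa> Ti (- U\<^sub>R)
      (\<alpha>_minus, u_minus, T_minus) (\<alpha>_sharp, u_sharp, T_sharp)"
    using assms(8) by (auto simp: reflected_shock_def)
  have p0: "p\<^sub>0 > 0" and p1: "p\<^sub>1 > 0"
    unfolding p\<^sub>0_def p\<^sub>1_def using assms \<alpha> T1 by (auto intro!: pressure_pos)
  have th: "theta \<alpha>_minus T_minus > 0" "theta \<alpha>_sharp T_sharp > 0"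
    using assms \<alpha> T1 by (simp_all add: theta_def)
  have pv: "p\<^sub>0 * v\<^sub>0 = a\<^sup>2 * theta \<alpha>_minus T_minus" "p\<^sub>1 * v\<^sub>1 = a\<^sup>2 * theta \<alpha>_sharp T_sharp"
    using p0 p1 by (simp_all add: v\<^sub>0_def v\<^sub>1_def density_def p\<^sub>0_def p\<^sub>1_def)
  have v0: "v\<^sub>0 > 0" and v1: "v\<^sub>1 > 0"
    using p0 p1 th assms(1) by (simp_all add: v\<^sub>0_def v\<^sub>1_def density_def p\<^sub>0_def p\<^sub>1_def)
  have \<rho>: "density a \<kappa> Ti \<alpha>_minus T_minus = 1 / v\<^sub>0" "density a \<kappa> Ti \<alpha>_sharp T_sharp = 1 / v\<^sub>1"
    by (simp_all add: v\<^sub>0_def v\<^sub>1_def)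
  have E: "total_energy a Ti \<alpha>_minus u_minus T_minus = u_minus\<^sup>2 / 2 + e\<^sub>0"
    "total_energy a Ti \<alpha>_sharp u_sharp T_sharp = e\<^sub>1"
    by (simp_all add: total_energy_def e\<^sub>0_def e\<^sub>1_def u1)
  have "- U\<^sub>R * (1 / v\<^sub>1 - 1 / v\<^sub>0) = - (1 / v\<^sub>0 * u_minus) \<and>
      - U\<^sub>R * - (1 / v\<^sub>0 * u_minus) = p\<^sub>1 - 1 / v\<^sub>0 * u_minus\<^sup>2 - p\<^sub>0 \<and>
      - U\<^sub>R * (1 / v\<^sub>1 * e\<^sub>1 - 1 / v\<^sub>0 * (u_minus\<^sup>2 / 2 + e\<^sub>0))
        = - (1 / v\<^sub>0 * u_minus * (u_minus\<^sup>2 / 2 + e\<^sub>0) + p\<^sub>0 * u_minus)"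
    using rh unfolding rankine_hugoniot_def Let_def split \<rho> E p\<^sub>0_def[symmetric] p\<^sub>1_def[symmetric]
    by (simp add: u1)
  then obtain m where R: "U\<^sub>R = m * v\<^sub>1" and Ru: "U\<^sub>R + u_minus = m * v\<^sub>0"
    and pm: "p\<^sub>1 - p\<^sub>0 = m * u_minus" and H: "2 * (e\<^sub>1 - e\<^sub>0) = (p\<^sub>1 + p\<^sub>0) * (v\<^sub>0 - v\<^sub>1)"
    using rankine_hugoniot_flux[OF p0 v0 v1 assms(7)] by metis
  have e: "2 * (e\<^sub>1 - e\<^sub>0) = 3 * (p\<^sub>1 * v\<^sub>1 - p\<^sub>0 * v\<^sub>0) + 2 * (a\<^sup>2 * Ti * (\<alpha>_sharp - \<alpha>_minus))"
    unfolding e\<^sub>0_def e\<^sub>1_def internal_energy_def pv by (simp add: algebra_simps)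
  have "a\<^sup>2 * Ti * (\<alpha>_sharp - \<alpha>_minus) > 0" using assms \<alpha> by simp
  \<comment> \<open>The ionization energy is the strict surplus over the polytropic Hugoniot
    relation.\<close>
  with H e have hug: "v\<^sub>1 * (4 * p\<^sub>1 + p\<^sub>0) < v\<^sub>0 * (4 * p\<^sub>0 + p\<^sub>1)" by (simp add: algebra_simps)
  have p01: "p\<^sub>0 < p\<^sub>1"
    by (rule saha_hugoniot_compressive[OF _ _ _ _ _ _ _ _ p\<^sub>0_def p\<^sub>1_def pv hug])
      (use assms \<alpha> T1 in auto)
  then have "0 < m * u_minus" using pm by simp
  then have m: "m > 0" using assms(7) by (simp add: zero_less_mult_iff)
  have u: "u_minus = m * (v\<^sub>0 - v\<^sub>1)" using R Ru by (simp add: algebra_simps)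
  then have "0 < m * (v\<^sub>0 - v\<^sub>1)" using assms(7) by simp
  then have v01: "v\<^sub>1 < v\<^sub>0" using m by (simp add: zero_less_mult_iff)
  \<comment> \<open>The slope of the Rayleigh line, which links the flux bounds to
    velocities.\<close>
  have m2: "m\<^sup>2 * (v\<^sub>0 - v\<^sub>1) = p\<^sub>1 - p\<^sub>0" using pm u by (simp add: power2_eq_square)
  have "u_minus\<^sup>2 = (p\<^sub>1 - p\<^sub>0) * (v\<^sub>0 - v\<^sub>1)"
    unfolding m2[symmetric] u by (simp add: power2_eq_square)
  moreover have "p\<^sub>0 * v\<^sub>0 \<le> 3 * u_minus\<^sup>2"
    using assms(10) th assms(1) unfolding pv assms(9) by (simp add: field_simps)
  ultimately have D: "p\<^sub>0 * v\<^sub>0 \<le> 3 * ((p\<^sub>1 - p\<^sub>0) * (v\<^sub>0 - v\<^sub>1))" by simp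
  have "T_minus < T_sharp"
    by (rule temperature_less[OF _ _ _ _ _ _ _ p01[unfolded p\<^sub>0_def p\<^sub>1_def]])
      (use assms \<alpha> T1 in auto)
  then have "theta \<alpha>_minus T_minus \<le> theta \<alpha>_sharp T_sharp"
    unfolding theta_def using assms \<alpha> by (intro mult_mono) auto
  then have heat: "p\<^sub>0 * v\<^sub>0 \<le> p\<^sub>1 * v\<^sub>1" unfolding pv by (intro mult_left_mono) auto
  have c0: "c\<^sub>0\<^sup>2 < 5/3 * (p\<^sub>0 * v\<^sub>0)"
    unfolding pv c\<^sub>0_def using assms by (intro sound_speed_bounds) auto
  have c1: "p\<^sub>1 * v\<^sub>1 < c\<^sub>1\<^sup>2" "c\<^sub>1 \<ge> 0"
    unfolding pv c\<^sub>1_def using assms \<alpha> T1 by (auto intro!: sound_speed_bounds)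
  \<comment> \<open>The factor \<open>v\<^sub>0 - v\<^sub>1 > 0\<close> is carried along to avoid
    division and cancelled at the end; the same is done for the state ahead.\<close>
  have "U\<^sub>R\<^sup>2 * (v\<^sub>0 - v\<^sub>1) = v\<^sub>1 * (v\<^sub>1 * (m\<^sup>2 * (v\<^sub>0 - v\<^sub>1)))"
    unfolding R by (simp add: power2_eq_square)
  also have "\<dots> \<le> v\<^sub>1 * (p\<^sub>1 * (v\<^sub>0 - v\<^sub>1))"
    unfolding m2 using flux_bound_behind[OF p0 p01 v0 v1 hug D] v1 by (intro mult_left_mono) auto
  also have "\<dots> = (p\<^sub>1 * v\<^sub>1) * (v\<^sub>0 - v\<^sub>1)" by simp
  finally have "U\<^sub>R\<^sup>2 \<le> p\<^sub>1 * v\<^sub>1" using v01 by simp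
  with c1 have behind: "U\<^sub>R < c\<^sub>1" by (intro power2_less_imp_less[of "U\<^sub>R" c\<^sub>1]) auto
  have "(5/3 * (p\<^sub>0 * v\<^sub>0)) * (v\<^sub>0 - v\<^sub>1) = v\<^sub>0 * (5 * p\<^sub>0 * (v\<^sub>0 - v\<^sub>1)) / 3" by simp
  also have "\<dots> \<le> v\<^sub>0 * (3 * v\<^sub>0 * (p\<^sub>1 - p\<^sub>0)) / 3"
    using flux_bound_ahead[OF p0 p01 v0 v01 heat D] v0
    by (intro divide_right_mono mult_left_mono) auto
  also have "\<dots> = (U\<^sub>R + u_minus)\<^sup>2 * (v\<^sub>0 - v\<^sub>1)"
    unfolding m2[symmetric] Ru by (simp add: power2_eq_square)
  finally have "5/3 * (p\<^sub>0 * v\<^sub>0) \<le> (U\<^sub>R + u_minus)\<^sup>2" using v01 by simp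
  moreover have "U\<^sub>R > 0" using R m v1 by simp
  ultimately have ahead: "c\<^sub>0 < U\<^sub>R + u_minus"
    using c0 assms(7) by (intro power2_less_imp_less[of c\<^sub>0]) auto
  show ?thesis using behind ahead \<open>U\<^sub>R > 0\<close> u1 unfolding c\<^sub>0_def c\<^sub>1_def by auto
qed

end
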